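(* Let $G$ be an undirected graph with a loop at every vertex, regarded as a symmetric digraph on its vertex set $V$. Then there exists a digraph $D$ on $V$ such that $G = D\cap D^T$ and $\operatorname{box}(G) = d_F(D)$. Moreover, $\operatorname{box}(G)\leq d_F(D)$ for every digraph $D$ on $V$ with $G = D\cap D^T$. Consequently, $$\operatorname{box}(G)=\min\{\, d_F(D) : D \text{ a digraph on } V \text{ with } G = D\cap D^T\,\}.$$
   Context: All graphs and digraphs are finite and may have loops; a digraph is identified with its $(0,1)$ adjacency matrix (diagonal entries record loops), and an undirected graph is identified with the symmetric digraph having the same adjacency matrix. For digraphs on a common vertex set, $D_1\cap D_2$ is the digraph whose arc set is the intersection of the arc sets. $D^T$ is the digraph whose adjacency matrix is the transpose of that of $D$. An interval graph (with a loop at every vertex) is a graph whose vertices can be assigned closed real intervals so that $u,v$ are adjacent (including $u=v$) iff their intervals intersect. The boxicity $\operatorname{box}(G)$ is the minimum number $b$ such that $G$ is the intersection of $b$ interval graphs on $V$ (equivalently, $G$ is the intersection graph of axis-parallel boxes in $\mathbb{R}^b$); the boxicity of a complete graph is taken to be $0$. A Ferrers digraph is a digraph whose successor sets $\{u : vu \text{ is an arc}\}$, $v\in V$, are linearly ordered by inclusion (equivalently, its adjacency matrix contains no $2\times 2$ permutation submatrix). The Ferrers dimension $d_F(D)$ is the minimum number of Ferrers digraphs on $V$ whose intersection is $D$ (with the convention that the intersection of an empty family is the complete digraph with all loops). *)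

theory Defs
  imports Complex_Main
begin

text \<open>
  A digraph on \<open>V\<close>, possibly with loops, is its arc set: a relation contained in \<open>V \<times> V\<close>. Its
  transpose is the converse relation, and the intersection of digraphs on \<open>V\<close> is the intersection
  of relations.
\<close>

definition digraph_on :: "'a set \<Rightarrow> 'a rel \<Rightarrow> bool" where
  "digraph_on V D \<longleftrightarrow> D \<subseteq> V \<times> V"

definition graph_on :: "'a set \<Rightarrow> 'a rel \<Rightarrow> bool" where
  "graph_on V G \<longleftrightarrow> digraph_on V G \<and> sym G"

text \<open>
  Assigned intervals are nonempty; the instance \<open>u = v\<close> therefore puts a loop at every vertex.
\<close>

definition interval_graph :: "'a set \<Rightarrow> 'a rel \<Rightarrow> bool" where
  "interval_graph V G \<longleftrightarrow>
    (\<exists>l r :: 'a \<Rightarrow> real. (\<forall>v\<in>V. l v \<le> r v) \<and>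
      G = {(u, v) \<in> V \<times> V. {l u..r u} \<inter> {l v..r v} \<noteq> {}})"

definition ferrers_digraph :: "'a set \<Rightarrow> 'a rel \<Rightarrow> bool" where
  "ferrers_digraph V D \<longleftrightarrow> digraph_on V D \<and>
    (\<forall>u\<in>V. \<forall>v\<in>V. D `` {u} \<subseteq> D `` {v} \<or> D `` {v} \<subseteq> D `` {u})"

text \<open>
  The outer \<open>V \<times> V\<close> matters only for \<open>k = 0\<close>: the intersection of the empty family is the complete
  digraph with all loops.
\<close>

definition is_intersection_of :: "'a set \<Rightarrow> ('a rel \<Rightarrow> bool) \<Rightarrow> nat \<Rightarrow> 'a rel \<Rightarrow> bool" where
  "is_intersection_of V P k D \<longleftrightarrow>
    (\<exists>F :: nat \<Rightarrow> 'a rel. (\<forall>i<k. P (F i)) \<and> D = (V \<times> V) \<inter> (\<Inter>i<k. F i))"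

text \<open>
  Both minima range over nonempty sets on finite \<open>V\<close>, for symmetric \<open>G\<close> with all loops and for
  arbitrary digraphs \<open>D\<close> respectively; see the two existence lemmas below.
\<close>

definition boxicity :: "'a set \<Rightarrow> 'a rel \<Rightarrow> nat" where
  "boxicity V G = (LEAST b. is_intersection_of V (interval_graph V) b G)"

definition ferrers_dimension :: "'a set \<Rightarrow> 'a rel \<Rightarrow> nat" where
  "ferrers_dimension V D = (LEAST k. is_intersection_of V (ferrers_digraph V) k D)"

lemma is_intersection_of_finite_image:
  assumes "finite S" and "\<And>x. x \<in> S \<Longrightarrow> P (f x)" and "D = (V \<times> V) \<inter> (\<Inter>x\<in>S. f x)"
  shows "\<exists>k. is_intersection_of V P k D"
proof -
  obtain k :: nat and e where e: "S = e ` {i. i < k}"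
    using finite_imp_nat_seg_image_inj_on[OF assms(1)] by metis
  have "is_intersection_of V P k D"
    unfolding is_intersection_of_def
    by (rule exI[of _ "f \<circ> e"]) (use assms(2,3) in \<open>auto simp: e\<close>)
  then show ?thesis ..
qed

lemma ferrers_dimension_exists:
  assumes "finite V" "digraph_on V D"
  shows "\<exists>k. is_intersection_of V (ferrers_digraph V) k D"
proof (rule is_intersection_of_finite_image)
  show "finite (V \<times> V - D)" using assms by simp
  show "ferrers_digraph V (V \<times> V - {p})" if "p \<in> V \<times> V - D" for p
    using that by (cases p) (auto simp: ferrers_digraph_def digraph_on_def)
  show "D = (V \<times> V) \<inter> (\<Inter>p\<in>V \<times> V - D. V \<times> V - {p})"
    using assms by (auto simp: digraph_on_def)
qed

lemma boxicity_exists: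
  assumes "finite V" "graph_on V G" "refl_on V G"
  shows "\<exists>b. is_intersection_of V (interval_graph V) b G"
proof (rule is_intersection_of_finite_image)
  show "finite (V \<times> V - G)" using assms by simp
  show "interval_graph V (V \<times> V - {p, prod.swap p})" if "p \<in> V \<times> V - G" for p
  proof -
    obtain x y where p: "p = (x, y)" by (cases p)
    have "x \<noteq> y" using that assms p by (auto simp: refl_on_def)
    then show ?thesis
      unfolding interval_graph_def p
      by (intro exI[of _ "\<lambda>v. if v = y then 1 else 0"] exI[of _ "\<lambda>v. if v = x then 0 else 1"])
        auto
  qed
  show "G = (V \<times> V) \<inter> (\<Inter>p\<in>V \<times> V - G. V \<times> V - {p, prod.swap p})"
    using assms by (auto simp: graph_on_def digraph_on_def sym_def)
qed

end

(* A closed interval graph with endpoints l and r is the symmetric part of the Ferrers digraph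
   {(u, v). l u \<le> r v}, and conversely every reflexive Ferrers digraph on a finite set has this form,
   with l u the negated outdegree of u and r v the largest l w over the predecessors w of v.
   Taking symmetric parts commutes with intersections, so a family of k Ferrers digraphs with
   intersection D corresponds to a family of k interval graphs with intersection D \<inter> D^T. *)

theory Submission
  imports Defs
begin

text \<open>Two nonempty closed intervals meet iff each begins no later than the other ends, so
  adjacency is the conjunction of one threshold condition with its transpose.\<close>

lemma interval_graph_symmetric_part:
  assumes "interval_graph V G"
  shows "\<exists>F. ferrers_digraph V F \<and> G = F \<inter> converse F"
proof -
  obtain l r :: "'a \<Rightarrow> real"
    where lr: "\<And>v. v \<in> V \<Longrightarrow> l v \<le> r v"
      and G: "G = {(u, v) \<in> V \<times> V. {l u..r u} \<inter> {l v..r v} \<noteq> {}}"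
    using assms unfolding interval_graph_def by auto
  define F where "F = {(u, v) \<in> V \<times> V. l u \<le> r v}"
  have "ferrers_digraph V F"
    unfolding ferrers_digraph_def digraph_on_def
  proof (intro conjI ballI)
    show "F \<subseteq> V \<times> V" by (auto simp: F_def)
    show "F `` {u} \<subseteq> F `` {v} \<or> F `` {v} \<subseteq> F `` {u}" if "u \<in> V" "v \<in> V" for u v
      \<comment> \<open>The successors of \<open>u\<close> are the vertices whose right endpoint is
        at least \<open>l u\<close>, so successor sets shrink as \<open>l\<close> grows.\<close>
      using that by (cases "l u \<le> l v") (auto simp: F_def)
  qed
  moreover have "G = F \<inter> converse F"
    using lr by (fastforce simp: G F_def)
  ultimately show ?thesis by blast
qed

text \<open>Nested finite successor sets are ordered by cardinality, so outdegree decides inclusion.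
  A vertex therefore reaches \<open>v\<close> as soon as its outdegree is at least the smallest
  outdegree among the predecessors of \<open>v\<close>.\<close>

lemma ferrers_digraph_threshold:
  assumes "finite V" and F: "ferrers_digraph V F" and refl: "refl_on V F"
  shows "\<exists>l r :: 'a \<Rightarrow> real. \<forall>u\<in>V. \<forall>v\<in>V. (u, v) \<in> F \<longleftrightarrow> l u \<le> r v"
proof -
  have sub: "F \<subseteq> V \<times> V"
    and nested: "\<And>u v. u \<in> V \<Longrightarrow> v \<in> V \<Longrightarrow> F `` {u} \<subseteq> F `` {v} \<or> F `` {v} \<subseteq> F `` {u}"
    using F unfolding ferrers_digraph_def digraph_on_def by auto
  have fin_succ: "finite (F `` {u})" for u
    using sub by (intro finite_subset[OF _ \<open>finite V\<close>]) auto
  have fin_pred: "finite (converse F `` {v})" for v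
    using sub by (intro finite_subset[OF _ \<open>finite V\<close>]) auto
  define l where "l u = - real (card (F `` {u}))" for u
  define r where "r v = Max (l ` (converse F `` {v}))" for v
  have "(u, v) \<in> F \<longleftrightarrow> l u \<le> r v" if "u \<in> V" "v \<in> V" for u v
  proof
    assume "(u, v) \<in> F"
    then show "l u \<le> r v"
      unfolding r_def using fin_pred by (intro Max_ge) auto
  next
    assume le: "l u \<le> r v"
    \<comment> \<open>The loop at \<open>v\<close> makes the set of predecessors nonempty, so the
      maximum is attained at some predecessor \<open>w\<close>.\<close>
    have "v \<in> converse F `` {v}"
      using refl \<open>v \<in> V\<close> by (auto simp: refl_on_def)
    then have "r v \<in> l ` (converse F `` {v})"
      unfolding r_def using fin_pred by (intro Max_in) auto
    then obtain w where w: "(w, v) \<in> F" "r v = l w" by auto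
    then have "card (F `` {w}) \<le> card (F `` {u})"
      using le by (simp add: l_def)
    \<comment> \<open>By nestedness the only other case is the reverse inclusion, which the
      cardinalities turn into an equality.\<close>
    then have "F `` {w} \<subseteq> F `` {u}"
      using nested[of u w] w(1) sub \<open>u \<in> V\<close> card_seteq[OF fin_succ] by blast
    then show "(u, v) \<in> F" using w(1) by auto
  qed
  then show ?thesis by blast
qed

lemma symmetric_part_interval_graph:
  assumes "finite V" "ferrers_digraph V F" "refl_on V F"
  shows "interval_graph V (F \<inter> converse F)"
proof -
  obtain l r :: "'a \<Rightarrow> real"
    where lr: "\<And>u v. u \<in> V \<Longrightarrow> v \<in> V \<Longrightarrow> (u, v) \<in> F \<longleftrightarrow> l u \<le> r v"
    using ferrers_digraph_threshold[OF assms] by blast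
  \<comment> \<open>Loops are what make the threshold functions endpoints of genuine
    intervals.\<close>
  have nonempty: "l v \<le> r v" if "v \<in> V" for v
    using lr[OF that that] assms(3) that by (auto simp: refl_on_def)
  have sub: "F \<subseteq> V \<times> V"
    using assms(2) by (simp add: ferrers_digraph_def digraph_on_def)
  have "(u, v) \<in> F \<inter> converse F \<longleftrightarrow> {l u..r u} \<inter> {l v..r v} \<noteq> {}"
    if "u \<in> V" "v \<in> V" for u v
    using lr[OF that] lr[OF that(2,1)] nonempty[OF that(1)] nonempty[OF that(2)] by auto
  then have "F \<inter> converse F = {(u, v) \<in> V \<times> V. {l u..r u} \<inter> {l v..r v} \<noteq> {}}"
    using sub by blast
  then show ?thesis
    unfolding interval_graph_def using nonempty by blast
qed

lemma boxicity_le_ferrers_dimension: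
  assumes "finite V" "refl_on V G" "digraph_on V D" and G: "G = D \<inter> converse D"
  shows "boxicity V G \<le> ferrers_dimension V D"
proof -
  define k where "k = ferrers_dimension V D"
  have "is_intersection_of V (ferrers_digraph V) k D"
    unfolding k_def ferrers_dimension_def
    using ferrers_dimension_exists[OF assms(1,3)] by (rule LeastI_ex)
  then obtain F where F: "\<And>i. i < k \<Longrightarrow> ferrers_digraph V (F i)"
    and D: "D = (V \<times> V) \<inter> (\<Inter>i<k. F i)"
    unfolding is_intersection_of_def by auto
  \<comment> \<open>Each \<open>F i\<close> contains \<open>D\<close>, hence \<open>G\<close>, and
    so inherits every loop of \<open>G\<close>.\<close>
  have "refl_on V (F i)" if "i < k" for i
    using that \<open>refl_on V G\<close> F[OF that] unfolding G D
    by (auto simp: refl_on_def ferrers_digraph_def digraph_on_def)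
  then have "interval_graph V (F i \<inter> converse (F i))" if "i < k" for i
    using symmetric_part_interval_graph[OF \<open>finite V\<close> F] that by blast
  moreover have "G = (V \<times> V) \<inter> (\<Inter>i<k. F i \<inter> converse (F i))"
    unfolding G D by auto
  ultimately have "is_intersection_of V (interval_graph V) k G"
    unfolding is_intersection_of_def by (intro exI[of _ "\<lambda>i. F i \<inter> converse (F i)"]) simp
  then show ?thesis
    unfolding k_def[symmetric] boxicity_def by (rule Least_le)
qed

text \<open>Choosing a Ferrers digraph for each member of an optimal interval family and
  intersecting the choices yields \<open>D\<close>. Together with the general lower bound this gives
  equality.\<close>

lemma ferrers_dimension_le_boxicity:
  assumes "finite V" "graph_on V G" "refl_on V G"
  shows "\<exists>D. digraph_on V D \<and> G = D \<inter> converse D \<and> ferrers_dimension V D \<le> boxicity V G"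
proof -
  define b where "b = boxicity V G"
  have "is_intersection_of V (interval_graph V) b G"
    unfolding b_def boxicity_def using boxicity_exists[OF assms] by (rule LeastI_ex)
  then obtain I where I: "\<And>i. i < b \<Longrightarrow> interval_graph V (I i)"
    and G: "G = (V \<times> V) \<inter> (\<Inter>i<b. I i)"
    unfolding is_intersection_of_def by auto
  have "\<exists>F. \<forall>i<b. ferrers_digraph V (F i) \<and> I i = F i \<inter> converse (F i)"
    using interval_graph_symmetric_part[OF I] by metis
  then obtain F where F: "\<And>i. i < b \<Longrightarrow> ferrers_digraph V (F i)"
    and IF: "\<And>i. i < b \<Longrightarrow> I i = F i \<inter> converse (F i)"
    by blast
  define D where "D = (V \<times> V) \<inter> (\<Inter>i<b. F i)"
  have "is_intersection_of V (ferrers_digraph V) b D"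
    unfolding is_intersection_of_def using F D_def by blast
  then have "ferrers_dimension V D \<le> b"
    unfolding ferrers_dimension_def by (rule Least_le)
  moreover have "G = D \<inter> converse D"
    unfolding G D_def using IF by auto
  moreover have "digraph_on V D"
    by (auto simp: digraph_on_def D_def)
  ultimately show ?thesis unfolding b_def by blast
qed

theorem theorem1:
  fixes V :: "'a set" and G :: "'a rel"
  assumes "finite V"
    and "graph_on V G"
    and "refl_on V G"
  shows "(\<exists>D. digraph_on V D \<and> G = D \<inter> converse D \<and> boxicity V G = ferrers_dimension V D) \<and>
    (\<forall>D. digraph_on V D \<and> G = D \<inter> converse D \<longrightarrow> boxicity V G \<le> ferrers_dimension V D) \<and>
    boxicity V G = Min {ferrers_dimension V D | D. digraph_on V D \<and> G = D \<inter> converse D}"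
proof -
  let ?S = "{ferrers_dimension V D | D. digraph_on V D \<and> G = D \<inter> converse D}"
  have lower: "boxicity V G \<le> ferrers_dimension V D"
    if "digraph_on V D" "G = D \<inter> converse D" for D
    using boxicity_le_ferrers_dimension[OF assms(1,3) that] .
  obtain D where D: "digraph_on V D" "G = D \<inter> converse D" "boxicity V G = ferrers_dimension V D"
    using ferrers_dimension_le_boxicity[OF assms] lower order_antisym by blast
  \<comment> \<open>\<open>Min\<close> is meaningful only on finite sets; here only finitely many
    digraphs on \<open>V\<close> compete.\<close>
  have "?S \<subseteq> ferrers_dimension V ` Pow (V \<times> V)"
    by (auto simp: digraph_on_def)
  then have "finite ?S"
    by (rule finite_subset) (simp add: assms(1))
  then have "Min ?S = boxicity V G"
  proof (rule Min_eqI)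
    show "boxicity V G \<le> n" if "n \<in> ?S" for n
      using that lower by blast
    show "boxicity V G \<in> ?S"
      using D by blast
  qed
  then show ?thesis
    using lower D by metis
qed

end
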